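(* Let $\mathbb{C}_n$ be the empirical copula, and $\mathbb{C}_n^\beta$ the empirical beta copula, of a sample $\boldsymbol{X}_1,\ldots,\boldsymbol{X}_n$ of $d$-variate vectors without ties in any of the $d$ components. Then $B_{(n,\ldots,n)}(\mathbb{C}_n)=\mathbb{C}_n^\beta$ as functions on $[0,1]^d$.
   Context: For $\boldsymbol{X}_i=(X_{i,1},\ldots,X_{i,d})$, "without ties in any of the $d$ components" means that for each $j$ the numbers $X_{1,j},\ldots,X_{n,j}$ are pairwise distinct. The ranks are $R_{i,j}^{(n)}=\sum_{k=1}^n\mathbf{1}\{X_{k,j}\le X_{i,j}\}$. The empirical copula is $\mathbb{C}_n(\boldsymbol{u})=\frac1n\sum_{i=1}^n\prod_{j=1}^d\mathbf{1}\{R_{i,j}^{(n)}/n\le u_j\}$, $\boldsymbol{u}\in[0,1]^d$. The empirical beta copula is $\mathbb{C}_n^\beta(\boldsymbol{u})=\frac1n\sum_{i=1}^n\prod_{j=1}^d F_{n,R_{i,j}^{(n)}}(u_j)$, where $F_{n,r}(u)=\sum_{s=r}^n\binom{n}{s}u^s(1-u)^{n-s}$ for $u\in[0,1]$, $r\in\{1,\ldots,n\}$. For $f:[0,1]^d\to\mathbb{R}$ and $\boldsymbol{m}=(m_1,\ldots,m_d)$ with positive integer entries, $$B_{\boldsymbol{m}}(f)(\boldsymbol{u})=\sum_{s_1=0}^{m_1}\cdots\sum_{s_d=0}^{m_d}f(s_1/m_1,\ldots,s_d/m_d)\prod_{j=1}^d p_{m_j,s_j}(u_j),\qquad p_{m,s}(u)=\binom{m}{s}u^s(1-u)^{m-s}.$$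 *)

theory Defs
  imports "HOL-Analysis.Analysis"
begin

text \<open>
  A sample of size \<open>n\<close> of \<open>d\<close>-variate vectors is a function \<open>X :: nat \<Rightarrow> real ^ 'd\<close>
  of which only the values at the indices \<open>1, \<dots>, n\<close> are used.
\<close>

definition no_ties :: "nat \<Rightarrow> (nat \<Rightarrow> real ^ 'd) \<Rightarrow> bool" where
  "no_ties n X \<longleftrightarrow> (\<forall>j. inj_on (\<lambda>i. X i $ j) {1..n})"

definition sample_rank :: "nat \<Rightarrow> (nat \<Rightarrow> real ^ 'd) \<Rightarrow> nat \<Rightarrow> 'd \<Rightarrow> nat" where
  "sample_rank n X i j = (\<Sum>k=1..n. of_bool (X k $ j \<le> X i $ j))"

definition empirical_copula ::
    "nat \<Rightarrow> (nat \<Rightarrow> real ^ 'd::finite) \<Rightarrow> real ^ 'd \<Rightarrow> real" where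
  "empirical_copula n X u =
     1 / real n * (\<Sum>i=1..n. \<Prod>j\<in>UNIV. of_bool (real (sample_rank n X i j) / real n \<le> u $ j))"

definition order_stat_cdf :: "nat \<Rightarrow> nat \<Rightarrow> real \<Rightarrow> real" where
  "order_stat_cdf n r u = (\<Sum>s=r..n. real (n choose s) * u ^ s * (1 - u) ^ (n - s))"

definition empirical_beta_copula ::
    "nat \<Rightarrow> (nat \<Rightarrow> real ^ 'd::finite) \<Rightarrow> real ^ 'd \<Rightarrow> real" where
  "empirical_beta_copula n X u =
     1 / real n * (\<Sum>i=1..n. \<Prod>j\<in>UNIV. order_stat_cdf n (sample_rank n X i j) (u $ j))"

text \<open>
  The iterated sum over \<open>0 \<le> s\<^sub>j \<le> m\<^sub>j\<close> is a single sum over the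
  multi-indices \<open>s\<close>. The argument \<open>f\<close> is only evaluated at points of the unit cube when
  all \<open>m\<^sub>j\<close> are positive.
\<close>

definition multi_Bernstein ::
    "('d \<Rightarrow> nat) \<Rightarrow> (real ^ 'd::finite \<Rightarrow> real) \<Rightarrow> real ^ 'd \<Rightarrow> real" where
  "multi_Bernstein m f u =
     (\<Sum>s \<in> (\<Pi>\<^sub>E j\<in>UNIV. {0..m j}).
        f (\<chi> j. real (s j) / real (m j)) * (\<Prod>j\<in>UNIV. Bernstein (m j) (s j) (u $ j)))"

end

theory Submission
  imports Defs
begin

text \<open>
  Bernstein operators are linear and map a product of functions of single coordinates to the
  product of the univariate Bernstein polynomials. The univariate Bernstein polynomial of the
  indicator of \<open>{r/n..}\<close> is the upper binomial tail, which is the distribution function of the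
  \<open>r\<close>-th order statistic.
\<close>

lemma multi_Bernstein_scale:
  "multi_Bernstein m (\<lambda>u. c * f u) u = c * multi_Bernstein m f u"
  by (simp add: multi_Bernstein_def sum_distrib_left mult.assoc)

lemma multi_Bernstein_sum:
  "multi_Bernstein m (\<lambda>u. \<Sum>i\<in>I. f i u) u = (\<Sum>i\<in>I. multi_Bernstein m (f i) u)"
  unfolding multi_Bernstein_def sum_distrib_right by (rule sum.swap)

text \<open>The Bernstein weight is itself a product over coordinates, so each summand is a product
  of factors depending on a single \<open>s j\<close>; distributivity (\<open>prod_sum_PiE\<close>)
  then factorizes the sum over multi-indices.\<close>

lemma multi_Bernstein_prod:
  fixes u :: "real ^ 'd::finite"
  shows "multi_Bernstein m (\<lambda>u. \<Prod>j\<in>UNIV. g j (u $ j)) u =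
    (\<Prod>j\<in>UNIV. \<Sum>s=0..m j. g j (real s / real (m j)) * Bernstein (m j) s (u $ j))"
  by (simp add: multi_Bernstein_def prod.distrib prod_sum_PiE)

lemma Bernstein_indicator_eq_order_stat_cdf:
  assumes "n \<ge> 1"
  shows "(\<Sum>s=0..n. of_bool (real r / real n \<le> real s / real n) * Bernstein n s u) =
    order_stat_cdf n r u"
proof -
  have "(\<Sum>s=0..n. of_bool (real r / real n \<le> real s / real n) * Bernstein n s u) =
      (\<Sum>s=0..n. if r \<le> s then Bernstein n s u else 0)"
    \<comment> \<open>Cancelling the denominators needs \<open>n\<close> positive: for
      \<open>n = 0\<close> both quotients would be 0 and the indicator constantly 1.\<close>
    using assms by (intro sum.cong) (auto simp: divide_le_cancel)
  also have "\<dots> = (\<Sum>s\<in>{s\<in>{0..n}. r \<le> s}. Bernstein n s u)"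
    by (rule sum.inter_filter[symmetric]) simp
  also have "{s\<in>{0..n}. r \<le> s} = {r..n}"
    by auto
  finally show ?thesis
    by (simp add: order_stat_cdf_def Bernstein_def)
qed

theorem lemma2p6:
  fixes X :: "nat \<Rightarrow> real ^ 'd::finite" and n :: nat
  assumes "n \<ge> 1" and "no_ties n X"
  shows "\<forall>u \<in> {u :: real ^ 'd. \<forall>j. 0 \<le> u $ j \<and> u $ j \<le> 1}.
           multi_Bernstein (\<lambda>_. n) (empirical_copula n X) u = empirical_beta_copula n X u"
proof
  fix u :: "real ^ 'd"
  have "multi_Bernstein (\<lambda>_. n) (empirical_copula n X) u =
      1 / real n * (\<Sum>i=1..n. multi_Bernstein (\<lambda>_. n)
        (\<lambda>u. \<Prod>j\<in>UNIV. of_bool (real (sample_rank n X i j) / real n \<le> u $ j)) u)"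
    unfolding empirical_copula_def multi_Bernstein_scale multi_Bernstein_sum ..
  also have "\<dots> = empirical_beta_copula n X u"
    \<comment> \<open>\<open>g\<close> is given explicitly to fix the higher-order match;
      \<open>for i\<close> keeps the sample index schematic, so that the rewriting works under the
      sum over \<open>i\<close>.\<close>
    unfolding empirical_beta_copula_def Bernstein_indicator_eq_order_stat_cdf[OF assms(1)]
      multi_Bernstein_prod[where g = "\<lambda>j x. of_bool (real (sample_rank n X i j) / real n \<le> x)" for i]
    ..
  finally show "multi_Bernstein (\<lambda>_. n) (empirical_copula n X) u = empirical_beta_copula n X u" .
qed

end
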